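(* Let $\mathbb{K}$ be an algebraic number field and let $N$ be a subgroup of $\mathsf{UT}(d,\mathbb{K})$. Let $M$ be a subsemigroup of $N$ and denote by $\overline{M}$ its image under the quotient map $N\to N/[N,N]$. If $\overline{M}=N/[N,N]$ (equivalently, if $M[N,N]=N$), then $M=N$.
   Context: $\mathsf{UT}(d,\mathbb{K})$ is the group of $d\times d$ upper-triangular matrices over $\mathbb{K}$ with all diagonal entries equal to $1$. $[N,N]$ is the commutator subgroup of $N$. The group $N$ is not assumed to be finitely generated. An algebraic number field is a finite extension of $\mathbb{Q}$. *)

theory Defs
  imports
    "Jordan_Normal_Form.Determinant"
    "HOL-Algebra.Generated_Groups"
begin

text \<open>
  A type of class \<^class>\<open>field_char_0\<close> contains \<open>\<rat>\<close> via \<^const>\<open>of_rat\<close>; it is an algebraic number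
  field if it is finite-dimensional as a \<open>\<rat>\<close>-vector space.
\<close>

definition number_field :: "'k::field_char_0 itself \<Rightarrow> bool" where
  "number_field _ \<longleftrightarrow>
     (\<exists>B. finite_dimensional_vector_space (\<lambda>(q::rat) (x::'k). of_rat q * x) B)"

definition UT :: "nat \<Rightarrow> 'k::field mat monoid" where
  "UT d =
     \<lparr>carrier = {A \<in> carrier_mat d d. upper_triangular A \<and> (\<forall>i<d. A $$ (i, i) = 1)},
      mult = (*),
      one = 1\<^sub>m d\<rparr>"

text \<open>The empty set is admitted as a subsemigroup.\<close>

definition subsemigroup :: "'a set \<Rightarrow> ('a, 'b) monoid_scheme \<Rightarrow> bool" where
  "subsemigroup M G \<longleftrightarrow> M \<subseteq> carrier G \<and> (\<forall>x\<in>M. \<forall>y\<in>M. x \<otimes>\<^bsub>G\<^esub> y \<in> M)"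

lemma UT_mult_row:
  fixes A B :: "'k::field mat"
  assumes A: "A \<in> carrier (UT d)" and B: "B \<in> carrier_mat d d"
    and i: "i < d" and j: "j < d"
    and zero: "\<And>k. i < k \<Longrightarrow> k < d \<Longrightarrow> B $$ (k, j) = 0"
  shows "(A * B) $$ (i, j) = B $$ (i, j)"
proof -
  have Ac: "A \<in> carrier_mat d d" and At: "\<And>k. k < i \<Longrightarrow> A $$ (i, k) = 0"
    and Ad: "A $$ (i, i) = 1"
    using A i by (auto simp: UT_def)
  have "(A * B) $$ (i, j) = (\<Sum>k = 0..<d. A $$ (i, k) * B $$ (k, j))"
    using Ac B i j by (simp add: scalar_prod_def)
  also have "\<dots> = (\<Sum>k = 0..<d. if k = i then B $$ (i, j) else 0)"
    using At Ad zero by (intro sum.cong) (auto dest: linorder_neqE_nat)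
  also have "\<dots> = B $$ (i, j)"
    using i by simp
  finally show ?thesis .
qed

lemma UT_group: "group (UT d :: 'k::field mat monoid)"
proof (rule groupI)
  fix A B :: "'k mat"
  assume A: "A \<in> carrier (UT d)" and B: "B \<in> carrier (UT d)"
  have Bc: "B \<in> carrier_mat d d" and Ac: "A \<in> carrier_mat d d"
    using A B by (auto simp: UT_def)
  have "(A * B) $$ (i, j) = B $$ (i, j)" if "j \<le> i" "i < d" for i j
    using that B by (intro UT_mult_row[OF A Bc]) (auto simp: UT_def)
  then show "A \<otimes>\<^bsub>UT d\<^esub> B \<in> carrier (UT d)"
    using Ac Bc B by (auto simp: UT_def upper_triangular_def)
next
  fix A :: "'k mat"
  assume A: "A \<in> carrier (UT d)"
  then have Ac: "A \<in> carrier_mat d d" and At: "upper_triangular A"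
    and Ad: "\<And>i. i < d \<Longrightarrow> A $$ (i, i) = 1"
    by (auto simp: UT_def)
  have "prod_list (diag_mat A) = 1"
    using Ac Ad by (auto simp: prod_list_diag_prod)
  then have det: "det A = 1"
    using det_upper_triangular[OF At Ac] by simp
  then obtain B where B: "B \<in> carrier_mat d d" and AB: "A * B = 1\<^sub>m d" and BA: "B * A = 1\<^sub>m d"
    using det_non_zero_imp_unit[OF Ac, of "()"] by (auto simp: Units_def ring_mat_def)
  have low: "B $$ (i, j) = 0" if "j < i" "i < d" for i j
    using that
  proof (induction "d - i" arbitrary: i rule: less_induct)
    case less
    have "(A * B) $$ (i, j) = B $$ (i, j)"
      using less by (intro UT_mult_row[OF A B]) auto
    then show ?case
      using less AB by simp
  qed
  have diag: "B $$ (i, i) = 1" if "i < d" for i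
  proof -
    have "(A * B) $$ (i, i) = B $$ (i, i)"
      using that low by (intro UT_mult_row[OF A B]) auto
    then show ?thesis
      using that AB by simp
  qed
  have "B \<in> carrier (UT d)"
    using B low diag by (auto simp: UT_def upper_triangular_def)
  then show "\<exists>B \<in> carrier (UT d). B \<otimes>\<^bsub>UT d\<^esub> A = \<one>\<^bsub>UT d\<^esub>"
    using BA by (auto simp: UT_def)
qed (auto simp: UT_def upper_triangular_def assoc_mult_mat)

end

theory Submission
  imports Defs
begin

text \<open>
  The heart of the matter is a group \<open>G\<close> with a central subgroup \<open>Z\<close> generated by commutators, and a
  subsemigroup \<open>M\<close> with \<open>M Z = G\<close>. Given \<open>x\<close> and \<open>y\<close>, choose elements of \<open>M\<close> that agree modulo \<open>Z\<close> with \<open>x\<close>, \<open>y\<close>,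
  \<open>inv x\<close> and \<open>inv y\<close>. The product of their \<open>n\<close>-th powers lies in \<open>M \<inter> Z\<close> and equals \<open>n\<^sup>2 c + n w\<close> in additive
  notation, where \<open>c = [x, y]\<close> and \<open>w\<close> is the sum of the four corrections. Exchanging \<open>x\<close> and \<open>y\<close> gives
  \<open>- n\<^sup>2 c + n w\<close> with the same \<open>w\<close>. Preorder \<open>Z\<close> by the cone of \<open>M \<inter> Z\<close>: then \<open>- w \<le> n c \<le> w\<close> for all \<open>n\<close>, so every
  generator \<open>c\<close> of \<open>Z\<close> is infinitesimal relative to some \<open>w\<close>. If \<open>Z\<close> has finite torsion-free rank, the sum \<open>u\<close> of
  finitely many such \<open>w\<close> dominates in this way all of \<open>Z\<close>, including \<open>u\<close> itself; so \<open>u \<le> 0\<close>, and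
  every element of \<open>Z\<close> is nonnegative (\<open>root_closure_eq_carrier\<close>). Therefore \<open>M \<inter> Z\<close> is a group, hence \<open>M\<close> is a group, which contains
  the commutators, and \<open>M = G\<close> (\<open>subsemigroup_full_mod_central\<close>).

  For a nilpotent group this is applied to the quotients by the successive terms of the lower central
  series, which carries \<open>M [G, G] = G\<close> down to \<open>M = G\<close> (\<open>subsemigroup_full_mod_derived\<close>).

  The number field provides the finite rank. The matrix entries, taken superdiagonal by superdiagonal,
  define a finite central series of the unitriangular group whose factors embed into the additive group
  of the field, which is a finite-dimensional rational vector space. Rank is additive along extensions,
  so every abelian section of the group has finite rank (\<open>finite_rank_on_extension\<close>,
  \<open>finite_rank_on_hom_image\<close>). The same series shows that the group is nilpotent.
\<close>

section \<open>Subsemigroups of abelian groups of finite rank\<close>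

text \<open>
  A subset of an abelian group has finite torsion-free rank iff it carries no infinite sequence that is
  linearly independent over the integers; a dependent sequence has an entry some positive power of which
  lies in the subgroup generated by the earlier entries. No uniform bound on the rank is recorded: the
  existence of such an entry is all that an ascending construction needs, and it passes to extensions
  without any counting.
\<close>

definition finite_rank_on :: "('a, 'b) monoid_scheme \<Rightarrow> 'a set \<Rightarrow> bool" where
  "finite_rank_on A T \<longleftrightarrow>
     (\<forall>z::nat \<Rightarrow> 'a. range z \<subseteq> T \<longrightarrow>
        (\<exists>i. \<exists>e>0. z i [^]\<^bsub>A\<^esub> (e::nat) \<in> generate A (z ` {..<i})))"

lemma (in monoid) nat_pow_mem:
  assumes "\<And>x y. x \<in> S \<Longrightarrow> y \<in> S \<Longrightarrow> x \<otimes> y \<in> S" and "S \<subseteq> carrier G" and "s \<in> S" and "0 < (k::nat)"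
  shows "s [^] k \<in> S"
proof -
  have "s [^] Suc j \<in> S" for j
    using assms(1-3) by (induction j) auto
  with \<open>0 < k\<close> show ?thesis
    by (metis gr0_implies_Suc)
qed

text \<open>
  The rational cone of \<open>S\<close>. For a nonempty subsemigroup \<open>S\<close> of an abelian group it consists of the nonnegative
  elements of the least translation-invariant preorder in which \<open>S\<close> is nonnegative and positive multiples
  can be cancelled.
\<close>

definition root_closure :: "('a, 'b) monoid_scheme \<Rightarrow> 'a set \<Rightarrow> 'a set" where
  "root_closure G S = {z \<in> carrier G. \<exists>k>0. z [^]\<^bsub>G\<^esub> (k::nat) \<in> S}"

text \<open>
  With \<open>R\<close> as nonnegative cone and additive notation, these are the \<open>z\<close> such that \<open>- u \<le> n z \<le> u\<close> for
  every \<open>n\<close>.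
\<close>

definition infinitesimal_to :: "('a, 'b) monoid_scheme \<Rightarrow> 'a set \<Rightarrow> 'a \<Rightarrow> 'a set" where
  "infinitesimal_to G R u =
     {z \<in> carrier G. \<forall>n::nat. u \<otimes>\<^bsub>G\<^esub> z [^]\<^bsub>G\<^esub> n \<in> R \<and> u \<otimes>\<^bsub>G\<^esub> inv\<^bsub>G\<^esub> z [^]\<^bsub>G\<^esub> n \<in> R}"

context comm_group
begin

lemma root_closure_mult:
  assumes S: "\<And>x y. x \<in> S \<Longrightarrow> y \<in> S \<Longrightarrow> x \<otimes> y \<in> S" "S \<subseteq> carrier G"
    and "x \<in> root_closure G S" "y \<in> root_closure G S"
  shows "x \<otimes> y \<in> root_closure G S"
proof -
  obtain k l where x: "x \<in> carrier G" "0 < k" "x [^] (k::nat) \<in> S"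
    and y: "y \<in> carrier G" "0 < l" "y [^] (l::nat) \<in> S"
    using assms(3,4) by (auto simp: root_closure_def)
  have "(x \<otimes> y) [^] (k * l) = (x [^] k) [^] l \<otimes> (y [^] l) [^] k"
    using x y by (simp add: nat_pow_distrib nat_pow_pow mult.commute)
  also have "\<dots> \<in> S"
    using S(1)[OF nat_pow_mem[OF S x(3) y(2)] nat_pow_mem[OF S y(3) x(2)]] .
  finally show ?thesis
    using x y by (auto simp: root_closure_def intro!: exI[of _ "k * l"])
qed

lemma root_closure_root:
  assumes "z [^] (k::nat) \<in> root_closure G S" "0 < k" "z \<in> carrier G"
  shows "z \<in> root_closure G S"
  using assms by (auto simp: root_closure_def nat_pow_pow) (metis nat_0_less_mult_iff)

lemma infinitesimal_to_inv:
  assumes "z \<in> infinitesimal_to G R u"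
  shows "inv z \<in> infinitesimal_to G R u"
  using assms by (auto simp: infinitesimal_to_def)

lemma infinitesimal_to_mult_bound:
  assumes R: "\<And>x y. x \<in> R \<Longrightarrow> y \<in> R \<Longrightarrow> x \<otimes> y \<in> R" "R \<subseteq> carrier G"
    and u: "u \<in> carrier G" and v: "v \<in> R"
    and z: "z \<in> infinitesimal_to G R u"
  shows "z \<in> infinitesimal_to G R (u \<otimes> v)"
proof -
  have zc: "z \<in> carrier G" and vc: "v \<in> carrier G"
    using z v R(2) by (auto simp: infinitesimal_to_def)
  have "u \<otimes> v \<otimes> y = (u \<otimes> y) \<otimes> v" if "y \<in> carrier G" for y
    using that u vc by (simp add: m_ac)
  then show ?thesis
    using z zc R(1) v by (auto simp: infinitesimal_to_def)
qed

lemma infinitesimal_to_mult: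
  assumes R: "\<And>x y. x \<in> R \<Longrightarrow> y \<in> R \<Longrightarrow> x \<otimes> y \<in> R" "R \<subseteq> carrier G"
    and root: "\<And>z k. z \<in> carrier G \<Longrightarrow> 0 < k \<Longrightarrow> z [^] (k::nat) \<in> R \<Longrightarrow> z \<in> R"
    and u: "u \<in> carrier G"
    and x: "x \<in> infinitesimal_to G R u" and y: "y \<in> infinitesimal_to G R u"
  shows "x \<otimes> y \<in> infinitesimal_to G R u"
proof -
  have key: "u \<otimes> (x' \<otimes> y') [^] n \<in> R"
    if x': "x' \<in> infinitesimal_to G R u" and y': "y' \<in> infinitesimal_to G R u" for x' y' and n :: nat
  proof (rule root[where k = 2])
    have c: "x' \<in> carrier G" "y' \<in> carrier G"
      using x' y' by (auto simp: infinitesimal_to_def)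
    have "y [^] (n * 2) = y [^] n \<otimes> y [^] n" if "y \<in> carrier G" for y
      using that by (simp add: nat_pow_mult mult_2_right)
    then have "(u \<otimes> (x' \<otimes> y') [^] n) [^] (2::nat) = (u \<otimes> x' [^] (n * 2)) \<otimes> (u \<otimes> y' [^] (n * 2))"
      using c u by (simp add: nat_pow_distrib numeral_2_eq_2 m_ac)
    also have "\<dots> \<in> R"
      using x' y' by (intro R(1)[of "u \<otimes> x' [^] (n * 2)"]) (auto simp: infinitesimal_to_def)
    finally show "(u \<otimes> (x' \<otimes> y') [^] n) [^] (2::nat) \<in> R" .
  qed (use x' y' u in \<open>auto simp: infinitesimal_to_def\<close>)
  have c: "x \<in> carrier G" "y \<in> carrier G"
    using x y by (auto simp: infinitesimal_to_def)
  have "u \<otimes> inv (x \<otimes> y) [^] n \<in> R" for n :: nat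
    using key[OF infinitesimal_to_inv[OF x] infinitesimal_to_inv[OF y], of n] c
    by (simp add: inv_mult)
  then show ?thesis
    using key[OF x y] c by (auto simp: infinitesimal_to_def)
qed

text \<open>
  The elements infinitesimal to \<open>u\<close> form an isolated subgroup: from \<open>u + n k z \<ge> 0\<close> and \<open>u \<ge> 0\<close> one gets
  \<open>k (u + n z) = (k - 1) u + (u + n k z) \<ge> 0\<close>, and the factor \<open>k\<close> cancels. This is why one integer relation
  between \<open>z\<close> and infinitesimal elements suffices to make \<open>z\<close> infinitesimal.
\<close>

lemma infinitesimal_to_root:
  assumes R: "\<And>x y. x \<in> R \<Longrightarrow> y \<in> R \<Longrightarrow> x \<otimes> y \<in> R" "R \<subseteq> carrier G"
    and root: "\<And>z k. z \<in> carrier G \<Longrightarrow> 0 < k \<Longrightarrow> z [^] (k::nat) \<in> R \<Longrightarrow> z \<in> R"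
    and u: "u \<in> R" and z: "z \<in> carrier G" and k: "0 < k"
    and zk: "z [^] (k::nat) \<in> infinitesimal_to G R u"
  shows "z \<in> infinitesimal_to G R u"
proof -
  obtain j where j: "k = Suc j"
    using k gr0_implies_Suc by blast
  have uc: "u \<in> carrier G"
    using u R(2) by blast
  have key: "u \<otimes> y [^] n \<in> R" if y: "y \<in> carrier G" "\<And>n::nat. u \<otimes> (y [^] k) [^] n \<in> R" for y and n :: nat
  proof (rule root[OF _ k])
    have "(u \<otimes> y [^] n) [^] k = u [^] j \<otimes> (u \<otimes> (y [^] k) [^] n)"
      using uc y(1) by (simp add: nat_pow_distrib nat_pow_pow mult.commute j m_ac)
    moreover have "\<dots> \<in> R"
    proof (cases "j = 0")
      case False
      with y(2) show ?thesis
        by (intro R(1)[OF nat_pow_mem[OF R u]]) auto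
    qed (use y uc in simp)
    ultimately show "(u \<otimes> y [^] n) [^] k \<in> R"
      by simp
  qed (use y uc in auto)
  show ?thesis
    using zk z key[of z] key[of "inv z"]
    by (auto simp: infinitesimal_to_def nat_pow_inv)
qed

lemma subgroup_infinitesimal_to:
  assumes R: "\<And>x y. x \<in> R \<Longrightarrow> y \<in> R \<Longrightarrow> x \<otimes> y \<in> R" "R \<subseteq> carrier G"
    and root: "\<And>z k. z \<in> carrier G \<Longrightarrow> 0 < k \<Longrightarrow> z [^] (k::nat) \<in> R \<Longrightarrow> z \<in> R"
    and u: "u \<in> R"
  shows "subgroup (infinitesimal_to G R u) G"
proof (rule subgroupI)
  show "infinitesimal_to G R u \<subseteq> carrier G"
    by (auto simp: infinitesimal_to_def)
  have "\<one> \<in> infinitesimal_to G R u"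
    using u R(2) by (auto simp: infinitesimal_to_def)
  then show "infinitesimal_to G R u \<noteq> {}"
    by blast
qed (use assms in \<open>auto intro: infinitesimal_to_inv infinitesimal_to_mult\<close>)

text \<open>
  The hypothesis \<open>quad\<close> says \<open>\<plusminus> n\<^sup>2 c + n w \<ge> 0\<close>; dividing by \<open>n\<close> makes the generator \<open>c\<close> infinitesimal to
  its own \<open>w\<close>. Adding nonnegative elements to the bound keeps everything that was infinitesimal, so by
  finite rank finitely many bounds add up to a single \<open>u\<close> to which all of \<open>C\<close>, hence the whole group, is
  infinitesimal. In particular \<open>u\<close> is infinitesimal to itself, so \<open>- u = u + 2 (- u) \<ge> 0\<close>, and then
  \<open>z = (u + z) + (- u) \<ge> 0\<close> for every \<open>z\<close>.
\<close>

theorem root_closure_eq_carrier: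
  assumes S: "\<And>x y. x \<in> S \<Longrightarrow> y \<in> S \<Longrightarrow> x \<otimes> y \<in> S" "S \<subseteq> carrier G" "S \<noteq> {}"
    and rank: "finite_rank_on G (carrier G)"
    and gen: "C \<subseteq> carrier G" "generate G C = carrier G"
    and quad: "\<And>c. c \<in> C \<Longrightarrow> \<exists>w\<in>carrier G. \<forall>n>0.
        c [^] (n * n) \<otimes> w [^] (n::nat) \<in> S \<and> inv c [^] (n * n) \<otimes> w [^] n \<in> S"
  shows "root_closure G S = carrier G"
proof -
  define R where "R = root_closure G S"
  have R: "x \<otimes> y \<in> R" if "x \<in> R" "y \<in> R" for x y
    using root_closure_mult[OF S(1,2)] that by (simp add: R_def)
  have Rc: "R \<subseteq> carrier G"
    by (auto simp: R_def root_closure_def)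
  have root: "z \<in> R" if "z \<in> carrier G" "0 < k" "z [^] (k::nat) \<in> R" for z k
    using root_closure_root that by (simp add: R_def)
  note Rs = R Rc root
  have SR: "S \<subseteq> R"
    using S(2) by (auto simp: R_def root_closure_def intro!: exI[of _ "1::nat"])
  have small: "\<exists>w\<in>R. c \<in> infinitesimal_to G R w" if c: "c \<in> C" for c
  proof -
    obtain w where w: "w \<in> carrier G"
      and wS: "\<And>n::nat. 0 < n \<Longrightarrow> c [^] (n * n) \<otimes> w [^] n \<in> S"
              "\<And>n::nat. 0 < n \<Longrightarrow> inv c [^] (n * n) \<otimes> w [^] n \<in> S"
      using quad[OF c] by blast
    have cc: "c \<in> carrier G"
      using c gen(1) by blast
    have pos: "w \<otimes> y [^] n \<in> R"
      if y: "y \<in> carrier G" "\<And>n::nat. 0 < n \<Longrightarrow> y [^] (n * n) \<otimes> w [^] n \<in> S" and n: "0 < n" for y and n :: nat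
    proof (rule root[OF _ n])
      have "(w \<otimes> y [^] n) [^] n = y [^] (n * n) \<otimes> w [^] n"
        using w y by (simp add: nat_pow_distrib nat_pow_pow m_comm)
      then show "(w \<otimes> y [^] n) [^] n \<in> R"
        using y(2)[OF n] SR by auto
    qed (use w y in auto)
    \<comment> \<open>The case \<open>n = 0\<close> is not covered by \<open>quad\<close>; it follows from \<open>2 w = (w + c) + (w - c)\<close>.\<close>
    have wR: "w \<in> R"
    proof (rule root[where k = 2])
      have "(w \<otimes> c) \<otimes> (w \<otimes> d) = (w \<otimes> w) \<otimes> (c \<otimes> d)" if "d \<in> carrier G" for d
        using that w cc by (simp add: m_ac)
      then have "(w \<otimes> c) \<otimes> (w \<otimes> inv c) = (w \<otimes> w) \<otimes> (c \<otimes> inv c)"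
        using cc by simp
      also have "\<dots> = w [^] (2::nat)"
        using w cc by (simp add: numeral_2_eq_2)
      finally have "w [^] (2::nat) = (w \<otimes> c [^] (1::nat)) \<otimes> (w \<otimes> inv c [^] (1::nat))"
        using w cc by simp
      also have "\<dots> \<in> R"
        using R[OF pos[of c 1] pos[of "inv c" 1]] wS cc by simp
      finally show "w [^] (2::nat) \<in> R" .
    qed (use w in auto)
    have "w \<otimes> c [^] n \<in> R \<and> w \<otimes> inv c [^] n \<in> R" for n :: nat
      using pos[of c n] pos[of "inv c" n] wS cc wR w by (cases "n = 0") auto
    then show ?thesis
      using wR cc by (auto simp: infinitesimal_to_def)
  qed
  have "\<exists>u\<in>R. C \<subseteq> infinitesimal_to G R u"
  proof (rule ccontr)
    assume no: "\<not> (\<exists>u\<in>R. C \<subseteq> infinitesimal_to G R u)"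
    \<comment> \<open>Keep adding the bound of a generator that is not yet infinitesimal. The pairs are
      \<open>(current bound u, generator not infinitesimal to u)\<close>.\<close>
    have "\<exists>p. \<forall>n. (fst (p n) \<in> R \<and> snd (p n) \<in> C \<and> snd (p n) \<notin> infinitesimal_to G R (fst (p n)))
        \<and> (\<exists>v\<in>R. fst (p (Suc n)) = fst (p n) \<otimes> v \<and> snd (p n) \<in> infinitesimal_to G R v)"
    proof (rule dependent_nat_choice)
      obtain s where "s \<in> R"
        using S(3) SR by blast
      with no show "\<exists>x. fst x \<in> R \<and> snd x \<in> C \<and> snd x \<notin> infinitesimal_to G R (fst x)"
        by auto
    next
      fix x :: "'a \<times> 'a" and n :: nat
      assume x: "fst x \<in> R \<and> snd x \<in> C \<and> snd x \<notin> infinitesimal_to G R (fst x)"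
      then obtain v where v: "v \<in> R" "snd x \<in> infinitesimal_to G R v"
        using small by blast
      have "fst x \<otimes> v \<in> R"
        using R x v by blast
      with no obtain c where "c \<in> C" "c \<notin> infinitesimal_to G R (fst x \<otimes> v)"
        by blast
      then show "\<exists>y. (fst y \<in> R \<and> snd y \<in> C \<and> snd y \<notin> infinitesimal_to G R (fst y))
          \<and> (\<exists>v\<in>R. fst y = fst x \<otimes> v \<and> snd x \<in> infinitesimal_to G R v)"
        using v \<open>fst x \<otimes> v \<in> R\<close> by (intro exI[of _ "(fst x \<otimes> v, c)"]) auto
    qed
    then obtain p where p: "\<And>n. fst (p n) \<in> R" "\<And>n. snd (p n) \<in> C"
        "\<And>n. snd (p n) \<notin> infinitesimal_to G R (fst (p n))"
        "\<And>n. \<exists>v\<in>R. fst (p (Suc n)) = fst (p n) \<otimes> v \<and> snd (p n) \<in> infinitesimal_to G R v"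
      by blast
    define u where "u n = fst (p n)" for n
    define c where "c n = snd (p n)" for n
    have u: "u n \<in> R" "u n \<in> carrier G" and c: "c n \<in> C" "c n \<in> carrier G"
      and out: "c n \<notin> infinitesimal_to G R (u n)" for n
      using p Rc gen(1) by (auto simp: u_def c_def)
    have later: "c j \<in> infinitesimal_to G R (u n)" if "j < n" for j n
      using that
    proof (induction n)
      case (Suc n)
      obtain v where v: "v \<in> R" "u (Suc n) = u n \<otimes> v" "c n \<in> infinitesimal_to G R v"
        using p(4)[of n] by (auto simp: u_def c_def)
      have vc: "v \<in> carrier G"
        using v(1) Rc by blast
      show ?case
      proof (cases "j = n")
        case True
        then show ?thesis
          using infinitesimal_to_mult_bound[OF R Rc vc u(1)[of n] v(3)] v(2) vc u(2) by (simp add: m_comm)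
      next
        case False
        then show ?thesis
          using infinitesimal_to_mult_bound[OF R Rc u(2)[of n] v(1)] Suc v(2) by simp
      qed
    qed simp
    have "range c \<subseteq> carrier G"
      using c by blast
    then obtain i e where e: "0 < e" and ce: "c i [^] (e::nat) \<in> generate G (c ` {..<i})"
      using rank unfolding finite_rank_on_def by blast
    have "generate G (c ` {..<i}) \<subseteq> infinitesimal_to G R (u i)"
      using later by (intro generate_subgroup_incl subgroup_infinitesimal_to[OF Rs u(1)]) auto
    with ce have "c i \<in> infinitesimal_to G R (u i)"
      by (intro infinitesimal_to_root[OF Rs u(1) c(2) e]) auto
    with out show False by blast
  qed
  then obtain u where u: "u \<in> R" and "C \<subseteq> infinitesimal_to G R u"
    by blast
  moreover have "subgroup (infinitesimal_to G R u) G"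
    using Rs u by (rule subgroup_infinitesimal_to)
  ultimately have all: "carrier G \<subseteq> infinitesimal_to G R u"
    using generate_subgroup_incl gen by metis
  have uc: "u \<in> carrier G"
    using u Rc by blast
  then have "u \<otimes> inv u [^] (2::nat) \<in> R"
    using all by (auto simp: infinitesimal_to_def)
  moreover have "u \<otimes> inv u [^] (2::nat) = inv u"
    using uc by (simp add: numeral_2_eq_2 m_assoc[symmetric])
  ultimately have iu: "inv u \<in> R"
    by simp
  have "z \<in> R" if z: "z \<in> carrier G" for z
  proof -
    have "u \<otimes> z [^] (1::nat) \<in> R"
      using all z by (auto simp only: infinitesimal_to_def)
    then have "inv u \<otimes> (u \<otimes> z) \<in> R"
      using z by (intro R[OF iu]) simp
    then show ?thesis
      using uc z by (simp add: m_assoc[symmetric])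
  qed
  then show ?thesis
    using Rc by (auto simp: R_def)
qed

end

section \<open>Finite rank from maps into number fields\<close>

text \<open>
  The set \<open>E\<close> stands for an arbitrary rational subspace; the statement says that the first \<open>t\<close> values of
  \<open>f\<close> span all of them, without mentioning the span. Such a \<open>t\<close> exists because a basis of the span chosen
  among the values is finite.
\<close>

lemma number_field_finite_span:
  fixes f :: "nat \<Rightarrow> 'k::field_char_0"
  assumes "number_field TYPE('k)"
  obtains t where "\<And>E i. \<lbrakk>0 \<in> E; \<And>x y. x \<in> E \<Longrightarrow> y \<in> E \<Longrightarrow> x + y \<in> E;
      \<And>q x. x \<in> E \<Longrightarrow> of_rat q * x \<in> E; f ` {..<t} \<subseteq> E\<rbrakk> \<Longrightarrow> f i \<in> E"
proof -
  obtain B0 where "finite_dimensional_vector_space (\<lambda>(q::rat) (x::'k). of_rat q * x) B0"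
    using assms by (auto simp: number_field_def)
  then interpret V: finite_dimensional_vector_space "\<lambda>(q::rat) (x::'k). of_rat q * x" B0 .
  obtain B where B: "B \<subseteq> range f" "V.independent B" "range f \<subseteq> V.span B"
    using V.maximal_independent_subset by blast
  then have "finite B"
    using V.finiteI_independent by blast
  then obtain I where I: "finite I" "B = f ` I"
    using B(1) by (meson finite_subset_image)
  then obtain t where "I \<subseteq> {..<t}"
    using finite_nat_iff_bounded by blast
  then have "B \<subseteq> f ` {..<t}"
    using I by blast
  show thesis
  proof
    fix E i
    assume "0 \<in> E" "\<And>x y. x \<in> E \<Longrightarrow> y \<in> E \<Longrightarrow> x + y \<in> E"
      "\<And>q x. x \<in> E \<Longrightarrow> of_rat q * x \<in> E" "f ` {..<t} \<subseteq> E"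
    then have "V.span B \<subseteq> E"
      using \<open>B \<subseteq> f ` {..<t}\<close> by (intro V.span_minimal V.subspaceI) auto
    with B(3) show "f i \<in> E"
      by blast
  qed
qed

lemma (in group) additive_on_group:
  fixes \<phi> :: "'a \<Rightarrow> 'k::field_char_0"
  assumes add: "\<And>x y. x \<in> carrier G \<Longrightarrow> y \<in> carrier G \<Longrightarrow> \<phi> (x \<otimes> y) = \<phi> x + \<phi> y"
  shows "\<phi> \<one> = 0"
    and "x \<in> carrier G \<Longrightarrow> \<phi> (inv x) = - \<phi> x"
    and "x \<in> carrier G \<Longrightarrow> \<phi> (x [^] (n::nat)) = of_nat n * \<phi> x"
proof -
  show one: "\<phi> \<one> = 0"
    using add[of \<one> \<one>] by simp
  show "\<phi> (inv x) = - \<phi> x" if "x \<in> carrier G"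
    using add[of x "inv x"] that one by (simp add: eq_neg_iff_add_eq_0 add.commute)
  show "\<phi> (x [^] (n::nat)) = of_nat n * \<phi> x" if "x \<in> carrier G"
    using that by (induction n) (auto simp: one add distrib_right add.commute)
qed

text \<open>
  Clearing denominators turns a rational dependence between the values of an additive map into an
  equality between the value of a power and the value of a word in the first \<open>t\<close> elements. The set of \<open>v\<close>
  that have a positive integer multiple of the form \<open>\<phi> g\<close>, with \<open>g\<close> such a word, is a rational subspace.
\<close>

lemma (in group) number_field_valued_relations:
  fixes \<phi> :: "'a \<Rightarrow> 'k::field_char_0" and h :: "nat \<Rightarrow> 'a"
  assumes nf: "number_field TYPE('k)"
    and add: "\<And>x y. x \<in> carrier G \<Longrightarrow> y \<in> carrier G \<Longrightarrow> \<phi> (x \<otimes> y) = \<phi> x + \<phi> y"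
    and h: "range h \<subseteq> carrier G"
  obtains t where "\<And>i. \<exists>e>0. \<exists>g\<in>generate G (h ` {..<t}). \<phi> (h i [^] (e::nat)) = \<phi> g"
proof -
  obtain t where t: "\<And>E i. \<lbrakk>0 \<in> E; \<And>x y. x \<in> E \<Longrightarrow> y \<in> E \<Longrightarrow> x + y \<in> E;
      \<And>q x. x \<in> E \<Longrightarrow> of_rat q * x \<in> E; (\<lambda>i. \<phi> (h i)) ` {..<t} \<subseteq> E\<rbrakk> \<Longrightarrow> \<phi> (h i) \<in> E"
    using number_field_finite_span[OF nf, of "\<lambda>i. \<phi> (h i)"] by metis
  define H where "H = generate G (h ` {..<t})"
  have "subgroup H G"
    unfolding H_def using h by (intro generate_is_subgroup) auto
  then interpret H: subgroup H G .
  have H[simp]: "x \<in> carrier G" if "x \<in> H" for x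
    using that H.subset by blast
  have Hpow: "x [^] (n::nat) \<in> H" if "x \<in> H" for x n
    using that by (induction n) auto
  note \<phi> = additive_on_group[of \<phi>, OF add] add
  define E where "E = {v. \<exists>e>0. \<exists>g\<in>H. of_nat (e::nat) * v = \<phi> g}"
  have hE: "\<phi> (h i) \<in> E" for i
  proof (rule t)
    show "0 \<in> E"
      unfolding E_def using H.one_closed by (auto simp: \<phi>(1) intro!: exI[of _ "1::nat"] bexI[of _ \<one>])
    show "(\<lambda>i. \<phi> (h i)) ` {..<t} \<subseteq> E"
    proof
      fix v assume "v \<in> (\<lambda>i. \<phi> (h i)) ` {..<t}"
      then obtain i where "i < t" "v = \<phi> (h i)" by blast
      moreover from this have "h i \<in> H"
        unfolding H_def by (intro generate.incl) auto
      ultimately show "v \<in> E"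
        unfolding E_def by (auto intro!: exI[of _ "1::nat"] bexI[of _ "h i"])
    qed
  next
    fix x y assume "x \<in> E" "y \<in> E"
    then obtain e g e' g' where *: "0 < e" "g \<in> H" "of_nat (e::nat) * x = \<phi> g"
        "0 < e'" "g' \<in> H" "of_nat (e'::nat) * y = \<phi> g'"
      unfolding E_def by blast
    have "of_nat (e * e') * (x + y) = of_nat e' * (of_nat e * x) + of_nat e * (of_nat e' * y)"
      by (simp add: algebra_simps)
    also have "\<dots> = \<phi> (g [^] e' \<otimes> g' [^] e)"
      using * by (simp add: \<phi>)
    finally show "x + y \<in> E"
      unfolding E_def using * Hpow by (auto intro!: exI[of _ "e * e'"] bexI[of _ "g [^] e' \<otimes> g' [^] e"])
  next
    fix q x assume "x \<in> E"
    then obtain e g where *: "0 < e" "g \<in> H" "of_nat (e::nat) * x = \<phi> g"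
      unfolding E_def by blast
    obtain a b where q: "q = Rat.Fract a b" "0 < b" "coprime a b"
      by (cases q)
    obtain g' where g': "g' \<in> H" "\<phi> g' = of_int a * \<phi> g"
    proof (cases a rule: int_cases2)
      case (nonneg n)
      then show thesis
        using * Hpow by (intro that[of "g [^] n"]) (simp_all add: \<phi>)
    next
      case (nonpos n)
      then show thesis
        using * Hpow by (intro that[of "inv (g [^] n)"]) (simp_all add: \<phi>)
    qed
    have "of_nat (e * nat b) * (of_rat q * x) = of_int a * (of_nat e * x)"
      using q(2) by (simp add: q(1) of_rat_rat field_simps)
    also have "\<dots> = \<phi> g'"
      using * g'(2) by simp
    finally show "of_rat q * x \<in> E"
      unfolding E_def using * q(2) g'(1) by (auto intro!: exI[of _ "e * nat b"] bexI[of _ g'])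
  qed
  show thesis
  proof
    fix i
    have "h i \<in> carrier G"
      using h by blast
    with hE[of i] show "\<exists>e>0. \<exists>g\<in>generate G (h ` {..<t}). \<phi> (h i [^] (e::nat)) = \<phi> g"
      by (auto simp: E_def H_def \<phi>(3))
  qed
qed

text \<open>
  Rank is additive along extensions. Dividing powers of the later entries of a sequence by words in the
  first \<open>t\<close> entries produces a sequence in the kernel of \<open>\<phi>\<close>; a relation there, read in the commutative
  group \<open>A\<close>, is a relation for the original sequence. Only the image in \<open>A\<close> is commutative: this lets
  the lemma treat an abelian section of a nilpotent group by means of maps \<open>\<phi>\<close> that live on the group above
  and need not factor through the section.
\<close>

lemma finite_rank_on_extension:
  fixes \<phi> :: "'a \<Rightarrow> 'k::field_char_0"
  assumes nf: "number_field TYPE('k)"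
    and L: "group L" and A: "comm_group A" and \<pi>: "\<pi> \<in> hom L A"
    and add: "\<And>x y. x \<in> carrier L \<Longrightarrow> y \<in> carrier L \<Longrightarrow> \<phi> (x \<otimes>\<^bsub>L\<^esub> y) = \<phi> x + \<phi> y"
    and ker: "finite_rank_on A (\<pi> ` {x \<in> carrier L. \<phi> x = 0})"
  shows "finite_rank_on A (\<pi> ` carrier L)"
  unfolding finite_rank_on_def
proof (intro allI impI)
  interpret L: group L by fact
  interpret A: comm_group A by fact
  interpret \<pi>: group_hom L A \<pi>
    by unfold_locales fact
  note \<phi> = L.additive_on_group[of \<phi>, OF add] add
  fix z :: "nat \<Rightarrow> _"
  assume "range z \<subseteq> \<pi> ` carrier L"
  then have "\<forall>i. \<exists>x. x \<in> carrier L \<and> z i = \<pi> x"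
    by blast
  then obtain h where h: "\<And>i. h i \<in> carrier L" and zh: "\<And>i. z i = \<pi> (h i)"
    by metis
  then have "range h \<subseteq> carrier L"
    by blast
  then obtain t where t: "\<And>i. \<exists>e>0. \<exists>g\<in>generate L (h ` {..<t}). \<phi> (h i [^]\<^bsub>L\<^esub> (e::nat)) = \<phi> g"
    using L.number_field_valued_relations[where \<phi> = \<phi>, OF nf add] by blast
  define W where "W n = generate A (z ` {..<n})" for n
  have subW: "subgroup (W n) A" for n
    unfolding W_def using h by (intro A.generate_is_subgroup) (auto simp: zh)
  have W_mono: "W m \<subseteq> W n" if "m \<le> n" for m n
    unfolding W_def using that by (intro A.mono_generate image_mono) auto
  have Wz: "z i \<in> W n" if "i < n" for i n
    unfolding W_def using that by (intro generate.incl) auto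
  have Wpow: "x [^]\<^bsub>A\<^esub> (k::nat) \<in> W n" if "x \<in> W n" for x k n
    using that subgroup.one_closed[OF subW] subgroup.m_closed[OF subW] by (induction k) auto
  obtain e g where e: "\<And>i. 0 < e i" and g: "\<And>i. g i \<in> generate L (h ` {..<t})"
    and eg: "\<And>i. \<phi> (h (t + i) [^]\<^bsub>L\<^esub> (e i :: nat)) = \<phi> (g i)"
    using t[of "t + i" for i] by metis
  have gc: "g i \<in> carrier L" for i
    using g[of i] L.generate_incl[of "h ` {..<t}"] h by blast
  have gW: "\<pi> (g i) \<in> W t" for i
  proof -
    have "\<pi> ` generate L (h ` {..<t}) = W t"
      unfolding W_def using \<pi>.generate_img[of "h ` {..<t}"] h by (simp add: image_image zh image_subset_iff)
    with g show ?thesis by blast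
  qed
  define h' where "h' i = h (t + i) [^]\<^bsub>L\<^esub> e i \<otimes>\<^bsub>L\<^esub> inv\<^bsub>L\<^esub> (g i)" for i
  have h'c: "h' i \<in> carrier L" for i
    using h gc by (simp add: h'_def)
  have \<phi>h': "\<phi> (h' i) = 0" for i
    using eg[of i] h gc by (simp add: h'_def \<phi>)
  have \<pi>h': "\<pi> (h' i) = z (t + i) [^]\<^bsub>A\<^esub> e i \<otimes>\<^bsub>A\<^esub> inv\<^bsub>A\<^esub> \<pi> (g i)" for i
    using h gc by (simp add: h'_def zh \<pi>.hom_nat_pow)
  have h'W: "\<pi> (h' j) \<in> W (t + i)" if "j < i" for i j
    unfolding \<pi>h' using that Wz[of "t + j" "t + i"] gW[of j] W_mono[of t "t + i"]
    by (intro subgroup.m_closed[OF subW] subgroup.m_inv_closed[OF subW] Wpow) auto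
  have "range (\<lambda>i. \<pi> (h' i)) \<subseteq> \<pi> ` {x \<in> carrier L. \<phi> x = 0}"
    using h'c \<phi>h' by blast
  then obtain i e' where e': "0 < e'" and
    rel: "\<pi> (h' i) [^]\<^bsub>A\<^esub> (e'::nat) \<in> generate A ((\<lambda>i. \<pi> (h' i)) ` {..<i})"
    using ker unfolding finite_rank_on_def by blast
  have "generate A ((\<lambda>i. \<pi> (h' i)) ` {..<i}) \<subseteq> W (t + i)"
    using h'W by (intro A.generate_subgroup_incl subW) auto
  with rel have relW: "\<pi> (h' i) [^]\<^bsub>A\<^esub> e' \<in> W (t + i)"
    by blast
  have zc: "z (t + i) \<in> carrier A"
    using h by (simp add: zh)
  have "z (t + i) [^]\<^bsub>A\<^esub> e i = \<pi> (h' i) \<otimes>\<^bsub>A\<^esub> \<pi> (g i)"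
    using zc gc by (simp add: \<pi>h' A.m_assoc)
  then have "z (t + i) [^]\<^bsub>A\<^esub> (e i * e') = \<pi> (h' i) [^]\<^bsub>A\<^esub> e' \<otimes>\<^bsub>A\<^esub> \<pi> (g i) [^]\<^bsub>A\<^esub> e'"
    using zc gc h'c by (simp add: A.nat_pow_pow[symmetric] A.nat_pow_distrib)
  also have "\<dots> \<in> W (t + i)"
    using gW[of i] W_mono[of t "t + i"] by (intro subgroup.m_closed[OF subW] relW Wpow) auto
  finally have "z (t + i) [^]\<^bsub>A\<^esub> (e i * e') \<in> generate A (z ` {..<t + i})"
    unfolding W_def .
  moreover have "0 < e i * e'"
    using e e' by simp
  ultimately show "\<exists>i. \<exists>e>0. z i [^]\<^bsub>A\<^esub> (e::nat) \<in> generate A (z ` {..<i})"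
    by blast
qed

section \<open>Subsemigroups that are full modulo a central subgroup\<close>

context group
begin

lemma central_mult_exchange:
  assumes "p \<in> carrier G" "q \<in> carrier G" "z \<in> carrier G" "w \<in> carrier G"
    and "\<And>g. g \<in> carrier G \<Longrightarrow> z \<otimes> g = g \<otimes> z"
  shows "(p \<otimes> z) \<otimes> (q \<otimes> w) = (p \<otimes> q) \<otimes> (z \<otimes> w)"
  using assms by (metis m_assoc m_closed)

lemma central_nat_pow:
  assumes "z \<in> carrier G" "g \<in> carrier G" and "\<And>g. g \<in> carrier G \<Longrightarrow> z \<otimes> g = g \<otimes> z"
  shows "z [^] (n::nat) \<otimes> g = g \<otimes> z [^] n"
proof (induction n)
  case (Suc n)
  have "z [^] Suc n \<otimes> g = z [^] n \<otimes> g \<otimes> z"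
    using assms by (simp add: m_assoc)
  with Suc assms show ?case
    by (simp add: m_assoc)
qed (use assms in simp)

lemma pow_swap_central_commutator:
  assumes x: "x \<in> carrier G" and y: "y \<in> carrier G" and c: "c \<in> carrier G"
    and central: "\<And>g. g \<in> carrier G \<Longrightarrow> c \<otimes> g = g \<otimes> c"
    and xy: "x \<otimes> y = c \<otimes> (y \<otimes> x)"
  shows "x [^] (n::nat) \<otimes> y [^] (m::nat) = c [^] (n * m) \<otimes> (y [^] m \<otimes> x [^] n)"
proof -
  have swap1: "u [^] n \<otimes> v = e [^] n \<otimes> (v \<otimes> u [^] n)"
    if u: "u \<in> carrier G" and v: "v \<in> carrier G" and e: "e \<in> carrier G"
      and ce: "\<And>g. g \<in> carrier G \<Longrightarrow> e \<otimes> g = g \<otimes> e" and uv: "u \<otimes> v = e \<otimes> (v \<otimes> u)"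
    for u v e and n :: nat
  proof (induction n)
    case (Suc n)
    have "u [^] Suc n \<otimes> v = u [^] n \<otimes> (e \<otimes> (v \<otimes> u))"
      using u v by (simp add: m_assoc uv)
    also have "\<dots> = e \<otimes> (u [^] n \<otimes> v) \<otimes> u"
      using u v e ce[of "u [^] n"] by (metis m_assoc m_closed nat_pow_closed)
    also have "\<dots> = (e \<otimes> e [^] n) \<otimes> (v \<otimes> (u [^] n \<otimes> u))"
      unfolding Suc using u v e by (simp add: m_assoc)
    also have "e \<otimes> e [^] n = e [^] Suc n"
      using e nat_pow_Suc2 by simp
    also have "u [^] n \<otimes> u = u [^] Suc n"
      by simp
    finally show ?case .
  qed (use u v in simp)
  \<comment> \<open>The powers of \<open>y\<close> are moved past \<open>x\<^sup>n\<close> by \<open>swap1\<close> again, now with \<open>y\<close> in the first place; exchanging the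
    factors replaces the commutator \<open>c\<^sup>n\<close> by its inverse.\<close>
  define e where "e = c [^] n"
  have e: "e \<in> carrier G" "\<And>g. g \<in> carrier G \<Longrightarrow> e \<otimes> g = g \<otimes> e"
    using c central_nat_pow[OF c _ central] by (auto simp: e_def)
  have xny: "x [^] n \<otimes> y = e \<otimes> (y \<otimes> x [^] n)"
    unfolding e_def by (rule swap1[OF x y c central xy])
  have "y \<otimes> x [^] n = inv e \<otimes> (x [^] n \<otimes> y)"
    using x y e(1) xny by (simp add: m_assoc[symmetric])
  moreover have "inv e \<otimes> g = g \<otimes> inv e" if "g \<in> carrier G" for g
    using e(1) e(2)[OF that] that by (metis inv_closed inv_solve_left inv_solve_right m_assoc m_closed)
  ultimately have "y [^] m \<otimes> x [^] n = inv e [^] m \<otimes> (x [^] n \<otimes> y [^] m)"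
    using x y e(1) by (intro swap1) auto
  then have "e [^] m \<otimes> (y [^] m \<otimes> x [^] n) = x [^] n \<otimes> y [^] m"
    using x y e(1) by (simp add: m_assoc[symmetric] nat_pow_inv)
  then show ?thesis
    using c by (simp add: e_def nat_pow_pow)
qed

text \<open>
  The source of the quadratic growth: correcting \<open>x\<close>, \<open>y\<close> and their inverses by central elements changes
  the commutator of \<open>n\<close>-th powers only by an \<open>n\<close>-th power, whereas the commutator itself is raised to the
  power \<open>n\<^sup>2\<close>.
\<close>

lemma commutator_powers_mod_central:
  assumes Z: "subgroup Z G" and central: "\<And>z g. z \<in> Z \<Longrightarrow> g \<in> carrier G \<Longrightarrow> z \<otimes> g = g \<otimes> z"
    and x: "x \<in> carrier G" and y: "y \<in> carrier G"
    and c: "x \<otimes> y \<otimes> inv x \<otimes> inv y \<in> Z"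
    and z: "z1 \<in> Z" "z2 \<in> Z" "z3 \<in> Z" "z4 \<in> Z"
  shows "(x \<otimes> z1) [^] n \<otimes> (y \<otimes> z2) [^] n \<otimes> (inv x \<otimes> z3) [^] n \<otimes> (inv y \<otimes> z4) [^] (n::nat)
    = (x \<otimes> y \<otimes> inv x \<otimes> inv y) [^] (n * n) \<otimes> (z1 \<otimes> z2 \<otimes> z3 \<otimes> z4) [^] n"
proof -
  define c where "c = x \<otimes> y \<otimes> inv x \<otimes> inv y"
  interpret Z: subgroup Z G by fact
  have Zc: "u \<in> carrier G" if "u \<in> Z" for u
    using that Z.subset by blast
  have Zpow: "u [^] (n::nat) \<in> Z" if "u \<in> Z" for u n
    using that by (induction n) auto
  have cZ: "c \<in> Z" and cc: "c \<in> carrier G"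
    using c Zc by (auto simp: c_def)
  have xy: "x \<otimes> y = c \<otimes> (y \<otimes> x)"
    using x y by (simp add: c_def inv_solve_right' m_assoc) (simp add: m_assoc[symmetric])
  have "x [^] n \<otimes> y [^] n = c [^] (n * n) \<otimes> (y [^] n \<otimes> x [^] n)"
    by (rule pow_swap_central_commutator[OF x y cc central[OF cZ] xy])
  then have comm: "x [^] n \<otimes> y [^] n \<otimes> inv x [^] n \<otimes> inv y [^] n = c [^] (n * n)"
    using x y cc by (simp add: nat_pow_inv m_assoc inv_solve_right')
  have split: "(g \<otimes> u) [^] n = g [^] n \<otimes> u [^] n" if "g \<in> carrier G" "u \<in> Z" for g u
    using that central[of u g] Zc by (intro pow_mult_distrib) auto
  have move: "(p \<otimes> u) \<otimes> (q \<otimes> v) = (p \<otimes> q) \<otimes> (u \<otimes> v)"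
    if "p \<in> carrier G" "q \<in> carrier G" "u \<in> Z" "v \<in> Z" for p q u v
    using that Zc central[of u] by (intro central_mult_exchange) auto
  have "(x \<otimes> z1) [^] n \<otimes> (y \<otimes> z2) [^] n \<otimes> (inv x \<otimes> z3) [^] n \<otimes> (inv y \<otimes> z4) [^] n
    = (x [^] n \<otimes> y [^] n \<otimes> inv x [^] n \<otimes> inv y [^] n) \<otimes> (z1 [^] n \<otimes> z2 [^] n \<otimes> z3 [^] n \<otimes> z4 [^] n)"
    using x y z Zpow by (simp add: split move)
  also have "z1 [^] n \<otimes> z2 [^] n \<otimes> z3 [^] n \<otimes> z4 [^] n = (z1 \<otimes> z2 \<otimes> z3 \<otimes> z4) [^] n"
    using z Zc by (simp add: split)
  finally show ?thesis
    unfolding comm by (simp add: c_def)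
qed

text \<open>
  The formula of \<open>commutator_powers_mod_central\<close> with the corrected elements taken in \<open>M\<close>, and its mirror image for \<open>y\<close> and \<open>x\<close>,
  yield \<open>n\<^sup>2 c + n w\<close> and \<open>- n\<^sup>2 c + n w\<close> in \<open>M \<inter> Z\<close> for the same \<open>w\<close>. Hence the cone of \<open>M \<inter> Z\<close> is all of \<open>Z\<close>,
  and this makes \<open>M \<inter> Z\<close> a group, since \<open>- k z \<in> M\<close> gives \<open>- z = - k z + (k - 1) z \<in> M\<close>. As every \<open>m \<in> M\<close> has an
  inverse in \<open>M\<close> up to an element of \<open>M \<inter> Z\<close>, also \<open>M\<close> is a group. It contains the commutators in \<open>C\<close> because
  central corrections do not change a commutator.
\<close>

theorem subsemigroup_full_mod_central:
  assumes Z: "subgroup Z G" and central: "\<And>z g. z \<in> Z \<Longrightarrow> g \<in> carrier G \<Longrightarrow> z \<otimes> g = g \<otimes> z"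
    and gen: "generate G C = Z"
    and C: "\<And>c. c \<in> C \<Longrightarrow> \<exists>x\<in>carrier G. \<exists>y\<in>carrier G. c = x \<otimes> y \<otimes> inv x \<otimes> inv y"
    and rank: "finite_rank_on (G\<lparr>carrier := Z\<rparr>) Z"
    and Mc: "M \<subseteq> carrier G" and M: "\<And>x y. x \<in> M \<Longrightarrow> y \<in> M \<Longrightarrow> x \<otimes> y \<in> M"
    and full: "M <#> Z = carrier G"
  shows "M = carrier G"
proof -
  interpret Z: subgroup Z G by fact
  have Zc: "u \<in> carrier G" if "u \<in> Z" for u
    using that Z.subset by blast
  have Mcc: "m \<in> carrier G" if "m \<in> M" for m
    using that Mc by blast
  let ?Z = "G\<lparr>carrier := Z\<rparr>"
  have "group ?Z"
    using Z is_group by (rule subgroup.subgroup_is_group)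
  then interpret Z': comm_group ?Z
    by (rule group.group_comm_groupI) (use central Zc in auto)
  have Mpow: "m [^] n \<in> M" if "m \<in> M" "0 < n" for m and n :: nat
    using that by (intro nat_pow_mem M Mc) auto
  have CZ: "C \<subseteq> Z"
    using gen generate.incl[of _ C G] by auto
  have lift: "\<exists>z\<in>Z. g \<otimes> z \<in> M" if g: "g \<in> carrier G" for g
  proof -
    obtain m z where "m \<in> M" "z \<in> Z" "g = m \<otimes> z"
      using g unfolding full[symmetric] by (auto simp: set_mult_def)
    then show ?thesis
      using Mcc Zc by (intro bexI[of _ "inv z"]) (auto simp: m_assoc)
  qed
  have "root_closure ?Z (M \<inter> Z) = carrier ?Z"
  proof (rule Z'.root_closure_eq_carrier)
    show "finite_rank_on ?Z (carrier ?Z)" using rank by simp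
    show "C \<subseteq> carrier ?Z" using CZ by simp
    show "generate ?Z C = carrier ?Z"
      using generate_consistent[OF CZ Z] gen by simp
    show "M \<inter> Z \<noteq> {}"
      using lift[OF one_closed] Zc by auto
  next
    fix c assume c: "c \<in> C"
    then obtain x y where x: "x \<in> carrier G" and y: "y \<in> carrier G"
      and cxy: "c = x \<otimes> y \<otimes> inv x \<otimes> inv y"
      using C by blast
    have cZ: "c \<in> Z"
      using c CZ by blast
    have icyx: "inv c = y \<otimes> x \<otimes> inv y \<otimes> inv x"
      using x y by (simp add: cxy inv_mult_group m_assoc)
    obtain z1 z2 z3 z4 where z: "z1 \<in> Z" "z2 \<in> Z" "z3 \<in> Z" "z4 \<in> Z"
      and zM: "x \<otimes> z1 \<in> M" "y \<otimes> z2 \<in> M" "inv x \<otimes> z3 \<in> M" "inv y \<otimes> z4 \<in> M"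
      using lift x y inv_closed by metis
    define w where "w = z1 \<otimes> z2 \<otimes> z3 \<otimes> z4"
    have w': "z2 \<otimes> z1 \<otimes> z4 \<otimes> z3 = w"
      using z Z'.m_ac by (simp add: w_def)
    have wZ: "w \<in> Z"
      using z by (simp add: w_def)
    have "c [^] (n * n) \<otimes> w [^] n \<in> M \<and> inv c [^] (n * n) \<otimes> w [^] n \<in> M" if n: "0 < n" for n :: nat
    proof
      show "c [^] (n * n) \<otimes> w [^] n \<in> M"
        using commutator_powers_mod_central[OF Z central x y _ z, of n] cZ
          M[OF M[OF M[OF Mpow[OF zM(1) n] Mpow[OF zM(2) n]] Mpow[OF zM(3) n]] Mpow[OF zM(4) n]]
        by (simp add: cxy w_def)
      show "inv c [^] (n * n) \<otimes> w [^] n \<in> M"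
        using commutator_powers_mod_central[OF Z central y x _ z(2,1,4,3), of n] Z.m_inv_closed[OF cZ]
          M[OF M[OF M[OF Mpow[OF zM(2) n] Mpow[OF zM(1) n]] Mpow[OF zM(4) n]] Mpow[OF zM(3) n]]
        by (simp add: icyx w')
    qed
    moreover have "u [^] n \<otimes> v [^] m \<in> Z" if "u \<in> Z" "v \<in> Z" for u v and n m :: nat
      using Z'.nat_pow_closed[of u n] Z'.nat_pow_closed[of v m] that
      by (simp add: nat_pow_consistent[symmetric])
    ultimately show "\<exists>w\<in>carrier ?Z. \<forall>n>0.
        c [^]\<^bsub>?Z\<^esub> (n * n) \<otimes>\<^bsub>?Z\<^esub> w [^]\<^bsub>?Z\<^esub> (n::nat) \<in> M \<inter> Z \<and>
        inv\<^bsub>?Z\<^esub> c [^]\<^bsub>?Z\<^esub> (n * n) \<otimes>\<^bsub>?Z\<^esub> w [^]\<^bsub>?Z\<^esub> n \<in> M \<inter> Z"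
      using wZ cZ Z by (intro bexI[of _ w]) (auto simp: nat_pow_consistent[symmetric])
  qed (use M in auto)
  then have roots: "root_closure ?Z (M \<inter> Z) = Z"
    by simp
  have inv_central: "inv z \<in> M" if z: "z \<in> M" "z \<in> Z" for z
  proof -
    have "inv z \<in> root_closure ?Z (M \<inter> Z)"
      using roots z by simp
    then obtain k where k: "0 < k" "inv z [^] (k::nat) \<in> M"
      by (auto simp: root_closure_def nat_pow_consistent[symmetric])
    then obtain j where j: "k = Suc j"
      using gr0_implies_Suc by blast
    show ?thesis
    proof (cases "j = 0")
      case False
      have "inv z [^] k \<otimes> z [^] j = inv z \<otimes> (inv z [^] j \<otimes> z [^] j)"
        unfolding j using nat_pow_Suc2[of "inv z" j] z Zc by (simp add: m_assoc)
      then have "inv z = inv z [^] k \<otimes> z [^] j"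
        using z Zc by (simp add: nat_pow_inv)
      with False k(2) z(1) show ?thesis
        by (metis M Mpow gr0I)
    qed (use k j z Zc in simp)
  qed
  have inv_M: "inv m \<in> M" if m: "m \<in> M" for m
  proof -
    obtain z where z: "z \<in> Z" "inv m \<otimes> z \<in> M"
      using lift[of "inv m"] m Mcc by auto
    have "z = m \<otimes> (inv m \<otimes> z)"
      using m Mcc z(1) Zc by (simp add: m_assoc[symmetric])
    then have "z \<in> M"
      using M[OF m z(2)] by simp
    then have "(inv m \<otimes> z) \<otimes> inv z \<in> M"
      using M[OF z(2) inv_central] z(1) by blast
    then show ?thesis
      using m Mcc z(1) Zc by (simp add: m_assoc)
  qed
  have "M \<noteq> {}"
    using lift[OF one_closed] by blast
  then have subM: "subgroup M G"
    using inv_M M Mc by (intro subgroupI) auto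
  have "C \<subseteq> M"
  proof
    fix c assume c: "c \<in> C"
    then obtain x y where x: "x \<in> carrier G" and y: "y \<in> carrier G"
      and cxy: "c = x \<otimes> y \<otimes> inv x \<otimes> inv y"
      using C by blast
    have cZ: "c \<in> Z"
      using c CZ by blast
    obtain z1 z2 where z: "z1 \<in> Z" "z2 \<in> Z" and zM: "x \<otimes> z1 \<in> M" "y \<otimes> z2 \<in> M"
      using lift x y by metis
    have inv_eq: "inv x \<otimes> inv z1 = inv (x \<otimes> z1)" "inv y \<otimes> inv z2 = inv (y \<otimes> z2)"
      using x y z Zc central by (simp_all add: inv_mult_group)
    have "z1 \<otimes> z2 \<otimes> inv z1 \<otimes> inv z2 = \<one>"
      using z Zc central[of z1 z2] by (simp add: m_assoc)
    then have "c = (x \<otimes> z1) \<otimes> (y \<otimes> z2) \<otimes> inv (x \<otimes> z1) \<otimes> inv (y \<otimes> z2)"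
      using commutator_powers_mod_central[OF Z central x y _ z Z.m_inv_closed[OF z(1)] Z.m_inv_closed[OF z(2)], of 1]
        cZ x y z Zc by (simp add: cxy inv_eq)
    also have "\<dots> \<in> M"
      by (intro M zM inv_M)
    finally show "c \<in> M" .
  qed
  then have "Z \<subseteq> M"
    using generate_subgroup_incl[OF _ subM] gen by blast
  then have "M <#> Z \<subseteq> M"
    using M by (auto simp: set_mult_def)
  with full Mc show ?thesis
    by blast
qed

end

section \<open>Descent along the lower central series\<close>

text \<open>
  Indexed from \<open>0\<close>, so that \<open>lower_central G 1\<close> is the derived subgroup.
\<close>

primrec lower_central :: "('a, 'b) monoid_scheme \<Rightarrow> nat \<Rightarrow> 'a set" where
  "lower_central G 0 = carrier G"
| "lower_central G (Suc j) = generate G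
     (\<Union>x\<in>carrier G. \<Union>y\<in>lower_central G j. {x \<otimes>\<^bsub>G\<^esub> y \<otimes>\<^bsub>G\<^esub> inv\<^bsub>G\<^esub> x \<otimes>\<^bsub>G\<^esub> inv\<^bsub>G\<^esub> y})"

declare lower_central.simps(2)[simp del]

lemma lower_central_1: "lower_central G (Suc 0) = derived G (carrier G)"
  by (simp add: derived_def lower_central.simps(2))

context group
begin

lemma lower_central_subset_commutator:
  assumes "x \<in> carrier G" "y \<in> lower_central G j"
  shows "x \<otimes> y \<otimes> inv x \<otimes> inv y \<in> lower_central G (Suc j)"
  using assms unfolding lower_central.simps(2) by (intro generate.incl) blast

text \<open>
  Both claims are proved together: once a term contains its successor, the identity
  \<open>g h inv g = [g, h] h\<close> shows that the term is closed under conjugation.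
\<close>

lemma normal_lower_central:
  shows "lower_central G j \<lhd> G" and "lower_central G (Suc j) \<subseteq> lower_central G j"
proof -
  have "lower_central G j \<lhd> G \<and> lower_central G (Suc j) \<subseteq> lower_central G j"
  proof (induction j)
    case 0
    have "generate G (\<Union>x\<in>carrier G. \<Union>y\<in>carrier G. {x \<otimes> y \<otimes> inv x \<otimes> inv y}) \<subseteq> carrier G"
      by (intro generate_subgroup_incl subgroup_self) auto
    then show ?case
      using normal_self by (simp add: lower_central.simps(2))
  next
    case (Suc j)
    then interpret N: normal "lower_central G j" G by blast
    let ?C = "\<lambda>j. \<Union>x\<in>carrier G. \<Union>y\<in>lower_central G j. {x \<otimes> y \<otimes> inv x \<otimes> inv y}"
    have "?C j \<subseteq> carrier G"
      using N.subset by auto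
    then have sub: "subgroup (lower_central G (Suc j)) G"
      using generate_is_subgroup by (simp add: lower_central.simps(2))
    have "?C (Suc j) \<subseteq> ?C j"
      using Suc by blast
    from mono_generate[OF this]
    have mono: "lower_central G (Suc (Suc j)) \<subseteq> lower_central G (Suc j)"
      by (simp only: lower_central.simps(2))
    have "lower_central G (Suc j) \<lhd> G"
    proof (rule normal_invI[OF sub])
      fix g h assume g: "g \<in> carrier G" and h: "h \<in> lower_central G (Suc j)"
      have hc: "h \<in> carrier G"
        using h sub subgroup.subset by blast
      have "g \<otimes> h \<otimes> inv g \<otimes> inv h \<in> lower_central G (Suc j)"
        using lower_central_subset_commutator[OF g, of h "Suc j"] h mono by blast
      then have "(g \<otimes> h \<otimes> inv g \<otimes> inv h) \<otimes> h \<in> lower_central G (Suc j)"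
        by (rule subgroup.m_closed[OF sub _ h])
      then show "g \<otimes> h \<otimes> inv g \<in> lower_central G (Suc j)"
        using g hc by (simp add: m_assoc)
    qed
    with mono show ?case by blast
  qed
  then show "lower_central G j \<lhd> G" "lower_central G (Suc j) \<subseteq> lower_central G j"
    by blast+
qed

text \<open>
  In the quotient by the next term \<open>K\<close> of the series the image \<open>Z\<close> of the current term \<open>H\<close> is central and
  generated by commutators, so that a subsemigroup covering the quotient modulo \<open>Z\<close> covers all of it. The
  hypothesis \<open>rank\<close> concerns all abelian homomorphic images of subgroups because \<open>Z\<close> is a section of the
  group and in general not a subgroup of it.
\<close>

lemma subsemigroup_lower_central_step:
  assumes rank: "\<And>H (A::'a set monoid) \<pi>. subgroup H G \<Longrightarrow> comm_group A \<Longrightarrow>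
      \<pi> \<in> hom (G\<lparr>carrier := H\<rparr>) A \<Longrightarrow> finite_rank_on A (\<pi> ` H)"
    and Mc: "M \<subseteq> carrier G" and M: "\<And>x y. x \<in> M \<Longrightarrow> y \<in> M \<Longrightarrow> x \<otimes> y \<in> M"
    and full: "M <#> lower_central G (Suc j) = carrier G"
  shows "M <#> lower_central G (Suc (Suc j)) = carrier G"
proof -
  define P where "P = lower_central G j"
  define H where "H = lower_central G (Suc j)"
  define K where "K = lower_central G (Suc (Suc j))"
  define C where "C = (\<Union>x\<in>carrier G. \<Union>y\<in>P. {x \<otimes> y \<otimes> inv x \<otimes> inv y})"
  interpret P: normal P G
    unfolding P_def by (rule normal_lower_central)
  interpret H: normal H G
    unfolding H_def by (rule normal_lower_central)
  interpret K: normal K G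
    unfolding K_def by (rule normal_lower_central)
  have Pc: "x \<in> carrier G" if "x \<in> P" for x
    using that P.subset by blast
  have Hc: "x \<in> carrier G" if "x \<in> H" for x
    using that H.subset by blast
  have Kc: "x \<in> carrier G" if "x \<in> K" for x
    using that K.subset by blast
  have Mcc: "x \<in> carrier G" if "x \<in> M" for x
    using that Mc by blast
  have HC: "H = generate G C" and Cc: "C \<subseteq> carrier G"
    using Pc by (auto simp: H_def C_def P_def lower_central.simps(2))
  let ?Q = "G Mod K"
  define \<pi> where "\<pi> = (\<lambda>x. K #> x)"
  interpret Q: group ?Q
    by (rule K.factorgroup_is_group)
  interpret \<pi>: group_hom G ?Q \<pi>
    using K.r_coset_hom_Mod by (unfold_locales) (simp add: \<pi>_def)
  have surj: "carrier ?Q = \<pi> ` carrier G"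
    by (simp add: carrier_FactGroup \<pi>_def)
  define Z where "Z = \<pi> ` H"
  have Z: "subgroup Z ?Q"
    unfolding Z_def by (rule \<pi>.subgroup_img_is_subgroup[OF H.subgroup_axioms])
  have central: "z \<otimes>\<^bsub>?Q\<^esub> g = g \<otimes>\<^bsub>?Q\<^esub> z" if zg: "z \<in> Z" "g \<in> carrier ?Q" for z g
  proof -
    obtain h x where h: "h \<in> H" "z = \<pi> h" and x: "x \<in> carrier G" "g = \<pi> x"
      using zg unfolding Z_def surj by blast
    have k: "x \<otimes> h \<otimes> inv x \<otimes> inv h \<in> K"
      unfolding K_def using x h by (intro lower_central_subset_commutator) (auto simp: H_def)
    have "\<pi> (x \<otimes> h \<otimes> inv x \<otimes> inv h) = \<one>\<^bsub>?Q\<^esub>"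
      using k K.rcos_const by (simp add: \<pi>_def)
    moreover have "x \<otimes> h = (x \<otimes> h \<otimes> inv x \<otimes> inv h) \<otimes> (h \<otimes> x)"
      using x(1) Hc[OF h(1)] by (simp add: m_assoc) (simp add: m_assoc[symmetric])
    ultimately have "\<pi> (x \<otimes> h) = \<pi> (h \<otimes> x)"
      using x(1) Hc[OF h(1)]
      by (metis \<pi>.hom_closed \<pi>.hom_mult Q.l_one Kc k m_closed)
    then show ?thesis
      using x h Hc by simp
  qed
  have QZ: "group (?Q\<lparr>carrier := Z\<rparr>)"
    using Z Q.is_group by (rule subgroup.subgroup_is_group)
  have Zc: "z \<in> carrier ?Q" if "z \<in> Z" for z
    using that Z subgroup.subset by blast
  have "comm_group (?Q\<lparr>carrier := Z\<rparr>)"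
    by (rule group.group_comm_groupI[OF QZ]) (use central Zc in auto)
  moreover have "\<pi> \<in> hom (G\<lparr>carrier := H\<rparr>) (?Q\<lparr>carrier := Z\<rparr>)"
    using Hc by (auto simp: hom_def Z_def)
  ultimately have rankZ: "finite_rank_on (?Q\<lparr>carrier := Z\<rparr>) Z"
    unfolding Z_def using H.subgroup_axioms by (intro rank) auto
  have "\<pi> ` M = carrier ?Q"
  proof (rule Q.subsemigroup_full_mod_central[OF Z central])
    show "generate ?Q (\<pi> ` C) = Z"
      using \<pi>.generate_img[OF Cc] HC by (simp add: Z_def)
    show "\<exists>x\<in>carrier ?Q. \<exists>y\<in>carrier ?Q. c = x \<otimes>\<^bsub>?Q\<^esub> y \<otimes>\<^bsub>?Q\<^esub> inv\<^bsub>?Q\<^esub> x \<otimes>\<^bsub>?Q\<^esub> inv\<^bsub>?Q\<^esub> y"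
      if c: "c \<in> \<pi> ` C" for c
    proof -
      obtain x y where x: "x \<in> carrier G" and y: "y \<in> carrier G" and "c = \<pi> (x \<otimes> y \<otimes> inv x \<otimes> inv y)"
        using c Pc unfolding C_def by blast
      then show ?thesis
        by (intro bexI[of _ "\<pi> x"] bexI[of _ "\<pi> y"]) simp_all
    qed
    show "finite_rank_on (?Q\<lparr>carrier := Z\<rparr>) Z" by fact
    show "\<pi> ` M \<subseteq> carrier ?Q"
      using Mcc by auto
    show "x \<otimes>\<^bsub>?Q\<^esub> y \<in> \<pi> ` M" if xy: "x \<in> \<pi> ` M" "y \<in> \<pi> ` M" for x y
    proof -
      obtain m n where mn: "m \<in> M" "x = \<pi> m" "n \<in> M" "y = \<pi> n"
        using xy by blast
      then have "x \<otimes>\<^bsub>?Q\<^esub> y = \<pi> (m \<otimes> n)"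
        using Mcc by simp
      then show ?thesis
        using M mn by blast
    qed
    show "\<pi> ` M <#>\<^bsub>?Q\<^esub> Z = carrier ?Q"
    proof -
      have "\<pi> ` M <#>\<^bsub>?Q\<^esub> Z = \<pi> ` (M <#> H)"
      proof -
        have eq: "\<pi> m \<otimes>\<^bsub>?Q\<^esub> \<pi> h = \<pi> (m \<otimes> h)" if "m \<in> M" "h \<in> H" for m h
          using \<pi>.hom_mult[OF Mcc[OF that(1)] Hc[OF that(2)]] by (rule sym)
        have "\<pi> ` M <#>\<^bsub>?Q\<^esub> Z = (\<Union>m\<in>M. \<Union>h\<in>H. {\<pi> m \<otimes>\<^bsub>?Q\<^esub> \<pi> h})"
          unfolding set_mult_def[of ?Q] Z_def by blast
        also have "\<dots> = (\<Union>m\<in>M. \<Union>h\<in>H. {\<pi> (m \<otimes> h)})"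
          using eq by (intro SUP_cong refl) simp
        also have "\<dots> = \<pi> ` (M <#> H)"
          unfolding set_mult_def by blast
        finally show ?thesis .
      qed
      then show ?thesis
        using full by (simp add: H_def surj)
    qed
  qed
  moreover have "carrier G \<subseteq> M <#> K" if "\<pi> ` M = carrier ?Q"
  proof
    fix g assume g: "g \<in> carrier G"
    then have "\<pi> g \<in> \<pi> ` M"
      using that by simp
    then obtain m where m: "m \<in> M" "\<pi> g = \<pi> m"
      by blast
    have "g \<in> K #> m"
      using m(2) g rcos_self[OF g K.subgroup_axioms] by (simp add: \<pi>_def)
    also have "K #> m = m <# K"
      using K.coset_eq Mcc[OF m(1)] by simp
    finally show "g \<in> M <#> K"
      using m(1) by (auto simp: l_coset_def set_mult_def)
  qed
  moreover have "M <#> K \<subseteq> carrier G"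
    using Mcc Kc by (auto simp: set_mult_def)
  ultimately show ?thesis
    by (simp add: K_def)
qed

text \<open>
  Iterating the step pushes \<open>M G' = G\<close> down the lower central series to \<open>M \<one> = G\<close>.
\<close>

theorem subsemigroup_full_mod_derived:
  assumes rank: "\<And>H (A::'a set monoid) \<pi>. subgroup H G \<Longrightarrow> comm_group A \<Longrightarrow>
      \<pi> \<in> hom (G\<lparr>carrier := H\<rparr>) A \<Longrightarrow> finite_rank_on A (\<pi> ` H)"
    and nilpotent: "lower_central G n = {\<one>}"
    and Mc: "M \<subseteq> carrier G" and M: "\<And>x y. x \<in> M \<Longrightarrow> y \<in> M \<Longrightarrow> x \<otimes> y \<in> M"
    and full: "M <#> derived G (carrier G) = carrier G"
  shows "M = carrier G"
proof -
  have "M <#> lower_central G (Suc j) = carrier G" for j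
  proof (induction j)
    case 0
    then show ?case
      using full by (simp only: lower_central_1)
  next
    case (Suc j)
    then show ?case
      by (intro subsemigroup_lower_central_step[OF rank Mc M])
  qed
  moreover have "lower_central G (Suc n) = {\<one>}"
    using normal_lower_central(2)[of n] nilpotent
      subgroup.one_closed[OF normal_imp_subgroup[OF normal_lower_central(1)[of "Suc n"]]]
    by auto
  ultimately have "M <#> {\<one>} = carrier G"
    by metis
  moreover have "M <#> {\<one>} = M"
    using Mc by (auto simp: set_mult_def) (metis r_one subsetD)+
  ultimately show ?thesis
    by simp
qed

lemma image_cosets_eq_carrier_iff:
  assumes "N \<lhd> G" and M: "M \<subseteq> carrier G"
  shows "(\<lambda>x. N #> x) ` M = carrier (G Mod N) \<longleftrightarrow> M <#> N = carrier G"
proof -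
  interpret N: normal N G by fact
  have Mcc: "x \<in> carrier G" if "x \<in> M" for x
    using that M by blast
  have mem: "g \<in> M <#> N \<longleftrightarrow> (\<exists>m\<in>M. N #> g = N #> m)" if g: "g \<in> carrier G" for g
  proof -
    have "g \<in> m <# N \<longleftrightarrow> N #> g = N #> m" if m: "m \<in> M" for m
      using N.coset_eq Mcc[OF m] g rcos_self[OF g N.subgroup_axioms]
        repr_independence[OF _ Mcc[OF m] N.subgroup_axioms, of g] by auto
    then show ?thesis
      by (auto simp: set_mult_def l_coset_def)
  qed
  have "M <#> N \<subseteq> carrier G"
    using set_mult_closed[OF M N.subset] .
  then have "M <#> N = carrier G \<longleftrightarrow> (\<forall>g\<in>carrier G. \<exists>m\<in>M. N #> g = N #> m)"
    using mem by blast
  also have "\<dots> \<longleftrightarrow> (\<lambda>x. N #> x) ` M = (\<lambda>x. N #> x) ` carrier G"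
  proof
    assume "\<forall>g\<in>carrier G. \<exists>m\<in>M. N #> g = N #> m"
    then show "(\<lambda>x. N #> x) ` M = (\<lambda>x. N #> x) ` carrier G"
      using M by blast
  next
    assume eq: "(\<lambda>x. N #> x) ` M = (\<lambda>x. N #> x) ` carrier G"
    show "\<forall>g\<in>carrier G. \<exists>m\<in>M. N #> g = N #> m"
    proof
      fix g assume "g \<in> carrier G"
      then have "N #> g \<in> (\<lambda>x. N #> x) ` M"
        unfolding eq by blast
      then show "\<exists>m\<in>M. N #> g = N #> m"
        by blast
    qed
  qed
  finally show ?thesis
    by (simp add: carrier_FactGroup)
qed

end

section \<open>Central series with factors in a number field\<close>

text \<open>
  A descending series in which \<open>\<epsilon> p\<close> embeds the factor \<open>U p / U (p + 1)\<close> into the additive group of the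
  field. That \<open>\<epsilon> p\<close> is additive as soon as one of the two factors lies in \<open>U p\<close>, and not only on \<open>U p\<close>, is
  what makes the series central.
\<close>

locale additive_central_series = group G for G (structure) +
  fixes U :: "nat \<Rightarrow> 'a set" and \<epsilon> :: "nat \<Rightarrow> 'a \<Rightarrow> 'k::field_char_0" and n :: nat
  assumes number_field: "number_field TYPE('k)"
    and top: "U 0 = carrier G"
    and bottom: "U n = {\<one>}"
    and Suc_eq: "U (Suc p) = {x \<in> U p. \<epsilon> p x = 0}"
    and additive_left: "x \<in> U p \<Longrightarrow> y \<in> carrier G \<Longrightarrow> \<epsilon> p (x \<otimes> y) = \<epsilon> p x + \<epsilon> p y"
    and additive_right: "x \<in> carrier G \<Longrightarrow> y \<in> U p \<Longrightarrow> \<epsilon> p (x \<otimes> y) = \<epsilon> p x + \<epsilon> p y"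
begin

lemma decreasing: "p \<le> q \<Longrightarrow> U q \<subseteq> U p"
  by (induction rule: dec_induct) (auto simp: Suc_eq)

lemma subgroup_U: "subgroup (U p) G"
proof (induction p)
  case 0
  show ?case
    unfolding top by (rule subgroup_self)
next
  case (Suc p)
  interpret S: subgroup "U p" G by fact
  interpret L: group "G\<lparr>carrier := U p\<rparr>"
    by (rule subgroup_imp_group[OF Suc])
  have add: "\<epsilon> p (x \<otimes> y) = \<epsilon> p x + \<epsilon> p y" if "x \<in> U p" "y \<in> U p" for x y
    using additive_left that S.subset by blast
  note \<epsilon> = L.additive_on_group[of "\<epsilon> p", simplified, OF add]
  have "\<one> \<in> U (Suc p)"
    using \<epsilon>(1) by (simp add: Suc_eq)
  then have "U (Suc p) \<noteq> {}"
    by blast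
  then show ?case
    using \<epsilon>(2) add Suc S.subset by (intro subgroupI) (simp_all add: Suc_eq subset_iff)
qed

text \<open>
  The rank of the image is bounded layer by layer, from the trivial bottom of the series upwards: each
  layer contributes at most the degree of the number field.
\<close>

lemma finite_rank_on_hom_image:
  fixes A :: "'c monoid"
  assumes H: "subgroup H G" and A: "comm_group A" and \<pi>: "\<pi> \<in> hom (G\<lparr>carrier := H\<rparr>) A"
  shows "finite_rank_on A (\<pi> ` H)"
proof -
  interpret A: comm_group A by fact
  have one: "\<one> \<in> H"
    using H by (rule subgroup.one_closed)
  have \<pi>1: "\<pi> \<one> = \<one>\<^bsub>A\<^esub>"
    using hom_one[OF \<pi> subgroup_imp_group[OF H] comm_group.axioms(2)[OF A]] by simp
  have "finite_rank_on A (\<pi> ` (H \<inter> U p))" if "p \<le> n" for p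
    using that
  proof (induction rule: inc_induct)
    case base
    have "\<pi> ` (H \<inter> U n) = {\<one>\<^bsub>A\<^esub>}"
      using one \<pi>1 by (simp add: bottom)
    \<comment> \<open>An entry of the trivial group is its own relation with no predecessors.\<close>
    have "z 0 [^]\<^bsub>A\<^esub> (1::nat) \<in> generate A (z ` {..<0})" if "range z \<subseteq> {\<one>\<^bsub>A\<^esub>}" for z :: "nat \<Rightarrow> 'c"
      using that generate.one[of A] by (auto simp: image_subset_iff A.nat_pow_one)
    then show ?case
      unfolding finite_rank_on_def \<open>\<pi> ` (H \<inter> U n) = {\<one>\<^bsub>A\<^esub>}\<close> 
      by (intro allI impI) (rule exI[of _ "0::nat"], rule exI[of _ "1::nat"], blast)
  next
    case (step p)
    have L: "subgroup (H \<inter> U p) G"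
      by (rule subgroups_Inter_pair[OF H subgroup_U])
    let ?L = "G\<lparr>carrier := H \<inter> U p\<rparr>"
    have "finite_rank_on A (\<pi> ` carrier ?L)"
    proof (rule finite_rank_on_extension[OF number_field _ A, where \<phi> = "\<epsilon> p"])
      show "group ?L"
        using L by (rule subgroup_imp_group)
      show "\<pi> \<in> hom ?L A"
        using \<pi> by (auto simp: hom_def)
      show "\<epsilon> p (x \<otimes>\<^bsub>?L\<^esub> y) = \<epsilon> p x + \<epsilon> p y" if "x \<in> carrier ?L" "y \<in> carrier ?L" for x y
        using that additive_left subgroup.subset[OF L] by auto
      have "{x \<in> carrier ?L. \<epsilon> p x = 0} = H \<inter> U (Suc p)"
        by (auto simp: Suc_eq)
      with step show "finite_rank_on A (\<pi> ` {x \<in> carrier ?L. \<epsilon> p x = 0})"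
        by simp
    qed
    then show ?case by simp
  qed
  from this[of 0] show ?thesis
    using subgroup.subset[OF H] by (simp add: top Int_absorb2)
qed

text \<open>
  Since \<open>y\<close> lies in \<open>U p\<close>, the coordinates up to \<open>p\<close> do not distinguish \<open>x y\<close> from \<open>y x\<close>; as the two differ
  by the left factor \<open>[x, y]\<close>, these coordinates of \<open>[x, y]\<close> vanish one after the other.
\<close>

lemma commutator_mem:
  assumes x: "x \<in> carrier G" and y: "y \<in> U p"
  shows "x \<otimes> y \<otimes> inv x \<otimes> inv y \<in> U (Suc p)"
proof -
  define c where "c = x \<otimes> y \<otimes> inv x \<otimes> inv y"
  have yc: "y \<in> carrier G"
    using y subgroup.subset[OF subgroup_U] by blast
  have c: "c \<in> carrier G"
    using x yc by (simp add: c_def)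
  have xy: "x \<otimes> y = c \<otimes> (y \<otimes> x)"
    using x yc by (simp add: c_def m_assoc) (simp add: m_assoc[symmetric])
  have "c \<in> U q" if "q \<le> Suc p" for q
    using that
  proof (induction q)
    case 0
    then show ?case
      using c by (simp add: top)
  next
    case (Suc q)
    then have cq: "c \<in> U q" and yq: "y \<in> U q"
      using y decreasing[of q p] by auto
    have "\<epsilon> q x + \<epsilon> q y = \<epsilon> q (c \<otimes> (y \<otimes> x))"
      using x yq by (simp add: xy[symmetric] additive_right)
    also have "\<dots> = \<epsilon> q c + (\<epsilon> q y + \<epsilon> q x)"
      using x yc cq yq by (simp add: additive_left)
    finally show ?case
      using cq by (simp add: Suc_eq)
  qed
  then show ?thesis
    by (simp add: c_def)
qed

lemma lower_central_subset: "lower_central G p \<subseteq> U p"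
proof (induction p)
  case (Suc p)
  then show ?case
    unfolding lower_central.simps(2) using commutator_mem
    by (intro generate_subgroup_incl subgroup_U) blast
qed (simp add: top)

theorem subsemigroup_full_mod_derived_eq_carrier:
  assumes Mc: "M \<subseteq> carrier G" and M: "\<And>x y. x \<in> M \<Longrightarrow> y \<in> M \<Longrightarrow> x \<otimes> y \<in> M"
    and full: "M <#> derived G (carrier G) = carrier G"
  shows "M = carrier G"
proof (rule subsemigroup_full_mod_derived[OF _ _ Mc M full])
  show "lower_central G n = {\<one>}"
    using lower_central_subset[of n] bottom
      subgroup.one_closed[OF normal_imp_subgroup[OF normal_lower_central(1)[of n]]] by blast
qed (rule finite_rank_on_hom_image)

end

section \<open>Unitriangular matrices\<close>

text \<open>
  The entries above the diagonal are enumerated along the superdiagonals, the one next to the diagonal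
  first: the position \<open>(a, b)\<close> receives the number \<open>(b - a) d + a\<close>. Numbers that encode no such position get
  the zero function, for which the corresponding layer is simply repeated.
\<close>

definition ut_entry :: "nat \<Rightarrow> nat \<Rightarrow> 'k::field mat \<Rightarrow> 'k" where
  "ut_entry d p A = (if 0 < p div d \<and> p mod d + p div d < d then A $$ (p mod d, p mod d + p div d) else 0)"

primrec ut_layer :: "nat \<Rightarrow> nat \<Rightarrow> 'k::field mat set" where
  "ut_layer d 0 = carrier (UT d)"
| "ut_layer d (Suc p) = {A \<in> ut_layer d p. ut_entry d p A = 0}"

lemma ut_layer_subset: "ut_layer d p \<subseteq> carrier (UT d)"
  by (induction p) auto

lemma ut_layer_entry_eq_0:
  assumes A: "A \<in> ut_layer d p" and ab: "a < b" "b < d" and p: "(b - a) * d + a < p"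
  shows "A $$ (a, b) = 0"
proof -
  have *: "A \<in> ut_layer d p \<Longrightarrow> q < p \<Longrightarrow> ut_entry d q A = 0" for q
    by (induction p) (auto simp: less_Suc_eq)
  have "((b - a) * d + a) mod d = a" "((b - a) * d + a) div d = b - a"
    using ab by auto
  with *[OF A p] ab show ?thesis
    by (simp add: ut_entry_def split: if_splits)
qed

lemma ut_layer_bottom: "ut_layer d (d * d) = {1\<^sub>m d}"
proof
  show "ut_layer d (d * d) \<subseteq> {1\<^sub>m d :: 'a mat}"
  proof
    fix A :: "'a mat" assume A: "A \<in> ut_layer d (d * d)"
    then have AU: "A \<in> carrier (UT d)"
      using ut_layer_subset by blast
    have upper: "A $$ (a, b) = 0" if "a < b" "b < d" for a b
    proof (rule ut_layer_entry_eq_0[OF A that])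
      have "(b - a) * d + a < Suc (b - a) * d"
        using that by simp
      also have "\<dots> \<le> d * d"
        using that by (intro mult_right_mono) auto
      finally show "(b - a) * d + a < d * d" .
    qed
    have "A = 1\<^sub>m d"
    proof (rule eq_matI)
      fix a b assume "a < dim_row (1\<^sub>m d :: 'a mat)" "b < dim_col (1\<^sub>m d :: 'a mat)"
      with AU upper[of a b] show "A $$ (a, b) = 1\<^sub>m d $$ (a, b)"
        by (cases a b rule: linorder_cases) (auto simp: UT_def upper_triangular_def)
    qed (use AU in \<open>auto simp: UT_def\<close>)
    then show "A \<in> {1\<^sub>m d}" by simp
  qed
  have "(1\<^sub>m d :: 'a mat) \<in> ut_layer d p" for p
  proof (induction p)
    case 0
    then show ?case
      using monoid.one_closed[OF group.is_monoid[OF UT_group[of d]]] by (simp add: UT_def)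
  qed (auto simp: ut_entry_def)
  then show "{1\<^sub>m d :: 'a mat} \<subseteq> ut_layer d (d * d)" by simp
qed

lemma UT_mult_entry:
  fixes A B :: "'k::field mat"
  assumes A: "A \<in> carrier (UT d)" and B: "B \<in> carrier (UT d)" and ab: "a < b" "b < d"
    and mid: "\<And>e. a < e \<Longrightarrow> e < b \<Longrightarrow> A $$ (a, e) * B $$ (e, b) = 0"
  shows "(A * B) $$ (a, b) = A $$ (a, b) + B $$ (a, b)"
proof -
  have "(A * B) $$ (a, b) = (\<Sum>e = 0..<d. A $$ (a, e) * B $$ (e, b))"
    using A B ab by (auto simp: UT_def scalar_prod_def)
  also have "\<dots> = (\<Sum>e \<in> {a, b}. A $$ (a, e) * B $$ (e, b))"
  proof (rule sum.mono_neutral_right)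
    show "\<forall>e\<in>{0..<d} - {a, b}. A $$ (a, e) * B $$ (e, b) = 0"
    proof
      fix e assume e: "e \<in> {0..<d} - {a, b}"
      consider "e < a" | "a < e" "e < b" | "b < e"
        using e by (cases "e < a"; cases "e < b") auto
      then show "A $$ (a, e) * B $$ (e, b) = 0"
        using A B ab e mid[of e] by cases (auto simp: UT_def upper_triangular_def)
    qed
  qed (use ab in auto)
  also have "\<dots> = A $$ (a, b) + B $$ (a, b)"
    using A B ab by (auto simp: UT_def)
  finally show ?thesis .
qed

text \<open>
  In the sum for the entry \<open>(a, b)\<close> of \<open>A B\<close>, every mixed term \<open>A(a, e) B(e, b)\<close> with \<open>a < e < b\<close> involves an entry of
  \<open>A\<close> and an entry of \<open>B\<close> on superdiagonals closer to the diagonal, hence with numbers below \<open>p\<close>; in the factor that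
  belongs to the layer \<open>p\<close> this entry is zero.
\<close>

lemma ut_entry_mult:
  fixes A B :: "'k::field mat"
  assumes A: "A \<in> carrier (UT d)" and B: "B \<in> carrier (UT d)"
    and layer: "A \<in> ut_layer d p \<or> B \<in> ut_layer d p"
  shows "ut_entry d p (A * B) = ut_entry d p A + ut_entry d p B"
proof (cases "0 < p div d \<and> p mod d + p div d < d")
  case True
  define a where "a = p mod d"
  define b where "b = p mod d + p div d"
  have ab: "a < b" "b < d"
    using True by (auto simp: a_def b_def)
  have p: "p = (b - a) * d + a"
    by (simp add: a_def b_def)
  have "A $$ (a, e) * B $$ (e, b) = 0" if e: "a < e" "e < b" for e
  proof -
    have "(e - a) * d + a < (b - a) * d + a"
      using e ab by simp
    moreover have "(b - e) * d + e < (b - a) * d + a"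
    proof -
      have "(b - e) * d + e < Suc (b - e) * d"
        using e ab by simp
      also have "\<dots> \<le> (b - a) * d"
        using e by (intro mult_right_mono) auto
      finally show ?thesis by simp
    qed
    ultimately have "A $$ (a, e) = 0 \<or> B $$ (e, b) = 0"
      using layer ut_layer_entry_eq_0[of A d p a e] ut_layer_entry_eq_0[of B d p e b] e ab p by auto
    then show ?thesis by auto
  qed
  then show ?thesis
    using UT_mult_entry[OF A B ab] True by (simp add: ut_entry_def a_def b_def)
qed (auto simp: ut_entry_def)

theorem theorem3p3:
  fixes d :: nat and N M :: "'k::field_char_0 mat set"
  assumes "number_field TYPE('k)"
    and "subgroup N (UT d)"
    and "subsemigroup M ((UT d)\<lparr>carrier := N\<rparr>)"
  shows "((\<lambda>x. derived (UT d) N #>\<^bsub>(UT d)\<lparr>carrier := N\<rparr>\<^esub> x) ` M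
            = carrier ((UT d)\<lparr>carrier := N\<rparr> Mod derived (UT d) N)
          \<longleftrightarrow> M <#>\<^bsub>UT d\<^esub> derived (UT d) N = N)
       \<and> ((\<lambda>x. derived (UT d) N #>\<^bsub>(UT d)\<lparr>carrier := N\<rparr>\<^esub> x) ` M
            = carrier ((UT d)\<lparr>carrier := N\<rparr> Mod derived (UT d) N)
          \<longrightarrow> M = N)"
proof -
  interpret UT: group "UT d :: 'k mat monoid"
    by (rule UT_group)
  let ?N = "(UT d)\<lparr>carrier := N\<rparr>"
  have NU: "A \<in> carrier (UT d)" if "A \<in> N" for A
    using that subgroup.subset[OF assms(2)] by blast
  have "group ?N"
    using assms(2) by (rule UT.subgroup_imp_group)
  then interpret N: additive_central_series ?N "\<lambda>p. N \<inter> ut_layer d p" "ut_entry d" "d * d"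
  proof (rule additive_central_series.intro, unfold_locales)
    show "number_field TYPE('k)" by fact
    show "N \<inter> ut_layer d (d * d) = {\<one>\<^bsub>?N\<^esub>}"
      using subgroup.one_closed[OF assms(2)] by (auto simp: ut_layer_bottom UT_def)
    show "N \<inter> ut_layer d 0 = carrier ?N"
      using NU by auto
    show "N \<inter> ut_layer d (Suc p) = {A \<in> N \<inter> ut_layer d p. ut_entry d p A = 0}" for p
      by auto
    show "ut_entry d p (A \<otimes>\<^bsub>?N\<^esub> B) = ut_entry d p A + ut_entry d p B"
      if "A \<in> N \<inter> ut_layer d p" "B \<in> carrier ?N" for A B p
      using ut_entry_mult[of A d B p] that NU by (auto simp: UT_def)
    show "ut_entry d p (A \<otimes>\<^bsub>?N\<^esub> B) = ut_entry d p A + ut_entry d p B"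
      if "A \<in> carrier ?N" "B \<in> N \<inter> ut_layer d p" for A B p
      using ut_entry_mult[of A d B p] that NU by (auto simp: UT_def)
  qed
  have M: "M \<subseteq> carrier ?N" "\<And>x y. x \<in> M \<Longrightarrow> y \<in> M \<Longrightarrow> x \<otimes>\<^bsub>?N\<^esub> y \<in> M"
    using assms(3) by (auto simp: subsemigroup_def)
  have D: "derived ?N (carrier ?N) = derived (UT d) N"
    using UT.derived_consistent[OF subset_refl assms(2)] by simp
  have iff: "(\<lambda>x. derived (UT d) N #>\<^bsub>?N\<^esub> x) ` M = carrier (?N Mod derived (UT d) N)
      \<longleftrightarrow> M <#>\<^bsub>UT d\<^esub> derived (UT d) N = N"
    using N.image_cosets_eq_carrier_iff[OF N.derived_self_is_normal M(1)] unfolding D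
    by (simp add: set_mult_def)
  moreover have "M = N" if "M <#>\<^bsub>UT d\<^esub> derived (UT d) N = N"
    using N.subsemigroup_full_mod_derived_eq_carrier[OF M] that unfolding D
    by (simp add: set_mult_def)
  ultimately show ?thesis
    by blast
qed

end
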